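(* Let $G$ be a $2$-connected cubic graph. Then $3\leq ak(G)\leq 4$.
   Context: Graphs are finite and simple. A graph is cubic if every vertex has degree $3$. A perfect matching of a graph is a set of pairwise non-adjacent edges that covers all vertices. For a connected graph $G$, an edge set $S\subseteq E(G)$ is called an anti-Kekulé set if $G-S$ is connected and has no perfect matching, where $G-S$ denotes the subgraph obtained from $G$ by deleting all edges in $S$ (all vertices are kept; $S$ may be empty). The anti-Kekulé number $ak(G)$ is the cardinality of a smallest anti-Kekulé set of $G$. *)

theory Defs
  imports Main "HOL-Library.Extended_Nat"
begin

text \<open>A graph is given by its vertex set and its edge set, an edge being the set of its two ends.\<close>

definition simple_graph :: "'a set \<Rightarrow> 'a set set \<Rightarrow> bool" where
  "simple_graph V E \<longleftrightarrow> finite V \<and> (\<forall>e\<in>E. e \<subseteq> V \<and> card e = 2)"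

definition degree :: "'a set set \<Rightarrow> 'a \<Rightarrow> nat" where
  "degree E v = card {e \<in> E. v \<in> e}"

definition cubic :: "'a set \<Rightarrow> 'a set set \<Rightarrow> bool" where
  "cubic V E \<longleftrightarrow> (\<forall>v\<in>V. degree E v = 3)"

definition connected_graph :: "'a set \<Rightarrow> 'a set set \<Rightarrow> bool" where
  "connected_graph V E \<longleftrightarrow>
     V \<noteq> {} \<and> (\<forall>u\<in>V. \<forall>v\<in>V. (u, v) \<in> {(x, y). {x, y} \<in> E}\<^sup>*)"

text \<open>The edge set in the second argument of \<^const>\<open>connected_graph\<close> below is that of the
  subgraph induced on \<open>V - X\<close>.\<close>

definition k_connected :: "nat \<Rightarrow> 'a set \<Rightarrow> 'a set set \<Rightarrow> bool" where
  "k_connected k V E \<longleftrightarrow>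
     card V > k \<and>
     (\<forall>X. X \<subseteq> V \<and> card X < k \<longrightarrow> connected_graph (V - X) {e \<in> E. e \<subseteq> V - X})"

definition perfect_matching :: "'a set \<Rightarrow> 'a set set \<Rightarrow> 'a set set \<Rightarrow> bool" where
  "perfect_matching V E M \<longleftrightarrow>
     M \<subseteq> E \<and> (\<forall>e\<in>M. \<forall>f\<in>M. e \<noteq> f \<longrightarrow> e \<inter> f = {}) \<and> \<Union>M = V"

definition anti_kekule_set :: "'a set \<Rightarrow> 'a set set \<Rightarrow> 'a set set \<Rightarrow> bool" where
  "anti_kekule_set V E S \<longleftrightarrow>
     S \<subseteq> E \<and> connected_graph V (E - S) \<and> \<not> (\<exists>M. perfect_matching V (E - S) M)"

text \<open>The value is \<open>\<infinity>\<close> if there is no anti-Kekule set, so an upper bound on it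
  by a number includes the existence of such a set.\<close>

definition anti_kekule_number :: "'a set \<Rightarrow> 'a set set \<Rightarrow> enat" where
  "anti_kekule_number V E = (INF S \<in> {S. anti_kekule_set V E S}. enat (card S))"

end

theory Submission imports Defs
begin

text \<open>
  Lower bound. Deleting at most two edges from a 2-connected cubic graph leaves a perfect matching
  (\<open>perfect_matching_avoiding_two_edges\<close>), which strengthens Petersen's theorem. If \<open>E - S\<close> had no perfect matching, the
  Tutte-Berge formula would give a vertex set \<open>U\<close> and more than \<open>card U\<close> disjoint odd
  sets joined in \<open>E - S\<close> only to \<open>U\<close>; as a cubic graph has an even number of vertices,
  there are at least \<open>card U + 2\<close> of them. In the whole graph an odd number of edges leaves
  each odd set, and a single edge would have a cut vertex at its end, so at least 3 edges leave.
  That is at least \<open>3 * card U + 6\<close> in total, whereas \<open>U\<close> receives at most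
  \<open>3 * card U\<close> of them and the two deleted edges count at most twice each.

  The Tutte-Berge formula is proved by induction on the number of vertices. A vertex that lies in
  every maximum matching is deleted and put into \<open>U\<close>. If there is none, Gallai's lemma
  applies: the relation "no maximum matching misses both vertices" is an equivalence relation
  that contains adjacency, and the classes of the vertices missed by one fixed maximum matching are
  the odd sets sought, with \<open>U = {}\<close>.

  Upper bound. Let \<open>a\<close> and \<open>b\<close> be two vertices with a common neighbour \<open>v\<close>.
  Deleting the other two edges at \<open>a\<close> and the other two at \<open>b\<close> makes both pendant at
  \<open>v\<close>, so they cannot both be matched. The result is connected as soon as \<open>{a, b}\<close>
  does not separate the graph, and \<open>non_separating_pair\<close> finds such a pair by an extremal
  choice.
\<close>

section \<open>Matchings\<close>

definition matching :: "'a set set \<Rightarrow> 'a set set \<Rightarrow> bool" where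
  "matching E M \<longleftrightarrow> M \<subseteq> E \<and> (\<forall>e\<in>M. \<forall>f\<in>M. e \<noteq> f \<longrightarrow> e \<inter> f = {})"

definition max_matching :: "'a set set \<Rightarrow> 'a set set \<Rightarrow> bool" where
  "max_matching E M \<longleftrightarrow> matching E M \<and> (\<forall>N. matching E N \<longrightarrow> card N \<le> card M)"

lemma simple_graphD:
  assumes "simple_graph V E"
  shows "finite V" "finite E" "e \<in> E \<Longrightarrow> e \<subseteq> V" "e \<in> E \<Longrightarrow> card e = 2" "e \<in> E \<Longrightarrow> finite e"
proof -
  show V: "finite V" using assms by (simp add: simple_graph_def)
  show sub: "e \<in> E \<Longrightarrow> e \<subseteq> V" for e using assms by (simp add: simple_graph_def)
  show "card e = 2" if "e \<in> E" for e using assms that by (simp add: simple_graph_def)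
  show "finite e" if "e \<in> E" using sub[OF that] V by (rule finite_subset)
  have "E \<subseteq> Pow V" using sub by blast
  then show "finite E" using V by (simp add: finite_subset)
qed

lemma edge_other_end:
  assumes "simple_graph V E" "e \<in> E" "x \<in> e"
  obtains y where "e = {x, y}" "y \<noteq> x" "y \<in> V"
proof -
  have "card e = 2" "e \<subseteq> V" using simple_graphD[OF assms(1)] assms(2) by auto
  then obtain p q where "e = {p, q}" "p \<noteq> q" by (auto simp: card_2_iff)
  then show thesis using that[of p] that[of q] assms(3) \<open>e \<subseteq> V\<close> by blast
qed

lemma simple_graph_subset: "simple_graph V E \<Longrightarrow> F \<subseteq> E \<Longrightarrow> simple_graph V F"
  by (auto simp: simple_graph_def)

lemma matching_finite: "simple_graph V E \<Longrightarrow> matching E M \<Longrightarrow> finite M"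
  using finite_subset[of M E] simple_graphD(2)[of V E] by (simp add: matching_def)

lemma card_Union_matching:
  assumes "simple_graph V E" "matching E M"
  shows "card (\<Union>M) = 2 * card M"
proof -
  have "card (\<Union>M) = sum card M"
    using assms simple_graphD(5)[OF assms(1)]
    by (intro card_Union_disjoint) (auto simp: matching_def pairwise_def disjnt_def)
  also have "\<dots> = (\<Sum>e\<in>M. 2)"
    using assms simple_graphD(4)[OF assms(1)] by (intro sum.cong) (auto simp: matching_def)
  finally show ?thesis by simp
qed

lemma Union_matching_subset: "simple_graph V E \<Longrightarrow> matching E M \<Longrightarrow> \<Union>M \<subseteq> V"
  using simple_graphD(3)[of V E] unfolding matching_def by blast

lemma max_matching_exists:
  assumes "simple_graph V E"
  obtains M where "max_matching E M"
proof -
  have "\<forall>M. matching E M \<longrightarrow> card M \<le> card E"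
    using simple_graphD(2)[OF assms] by (auto simp: matching_def card_mono)
  moreover have "matching E {}" by (simp add: matching_def)
  ultimately have "\<exists>M. matching E M \<and> (\<forall>N. matching E N \<longrightarrow> card N \<le> card M)"
    by (intro ex_has_greatest_nat[where b = "Suc (card E)"]) (auto simp: less_Suc_eq_le)
  then show thesis using that by (auto simp: max_matching_def)
qed

lemma max_matching_card_eq: "max_matching E M \<Longrightarrow> max_matching E N \<Longrightarrow> card M = card N"
  by (auto simp: max_matching_def intro: le_antisym)

lemma max_matchingI_card:
  "max_matching E M \<Longrightarrow> matching E N \<Longrightarrow> card N = card M \<Longrightarrow> max_matching E N"
  by (simp add: max_matching_def)

text \<open>An edge disjoint from the covered vertices could be added to the matching.\<close>

lemma max_matching_meets_edge:
  assumes G: "simple_graph V E" and M: "max_matching E M" and e: "e \<in> E"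
  shows "e \<inter> \<Union>M \<noteq> {}"
proof
  assume dis: "e \<inter> \<Union>M = {}"
  have "matching E (insert e M)"
    using M e dis by (auto simp: max_matching_def matching_def)
  then have "card (insert e M) \<le> card M" using M by (simp add: max_matching_def)
  moreover have "e \<noteq> {}" using simple_graphD(4)[OF G e] by auto
  then have "e \<notin> M" using dis by auto
  ultimately show False
    using matching_finite[OF G] M by (auto simp: max_matching_def)
qed

section \<open>Gallai's lemma and the Tutte-Berge formula\<close>

text \<open>The disjunct \<open>u = v\<close> makes the relation reflexive also at vertices that some maximum
  matching misses.\<close>

definition never_both_missed :: "'a set set \<Rightarrow> 'a \<Rightarrow> 'a \<Rightarrow> bool" where
  "never_both_missed E u v \<longleftrightarrow>
     u = v \<or> (\<forall>M. max_matching E M \<longrightarrow> u \<in> \<Union>M \<or> v \<in> \<Union>M)"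

lemma never_both_missed_sym: "never_both_missed E u v \<Longrightarrow> never_both_missed E v u"
  by (auto simp: never_both_missed_def)

lemma never_both_missed_edge:
  "simple_graph V E \<Longrightarrow> {u, v} \<in> E \<Longrightarrow> never_both_missed E u v"
  using max_matching_meets_edge[of V E _ "{u, v}"] by (auto simp: never_both_missed_def)

text \<open>This is the heart of Gallai's lemma. Suppose that a maximum matching \<open>M\<close> misses
  \<open>u\<close> and \<open>v\<close>. Among the maximum matchings that miss \<open>t\<close> take the one,
  \<open>N\<close>, that shares most edges with \<open>M\<close>. It covers \<open>u\<close> and \<open>v\<close>, which
  \<open>M\<close> does not, so \<open>M\<close> covers two vertices that \<open>N\<close> misses, hence one,
  \<open>x\<close>, besides \<open>t\<close>. Exchanging the \<open>N\<close>-edge at the \<open>M\<close>-partner of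
  \<open>x\<close> for the \<open>M\<close>-edge at \<open>x\<close> yields a maximum matching that misses \<open>t\<close>
  and shares one more edge with \<open>M\<close>.\<close>

lemma never_both_missed_trans:
  assumes G: "simple_graph V E"
    and missed: "\<exists>M. max_matching E M \<and> t \<notin> \<Union>M"
    and ut: "never_both_missed E u t" and tv: "never_both_missed E t v"
  shows "never_both_missed E u v"
proof (rule ccontr)
  assume "\<not> never_both_missed E u v"
  then obtain M where M: "max_matching E M" "u \<notin> \<Union>M" "v \<notin> \<Union>M" and "u \<noteq> v"
    by (auto simp: never_both_missed_def)
  have ne: "u \<noteq> t" "t \<noteq> v" using ut tv \<open>\<not> never_both_missed E u v\<close> by auto
  have mM: "matching E M" and finM: "finite M"
    using M(1) matching_finite[OF G] by (auto simp: max_matching_def)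
  have "\<exists>N. (max_matching E N \<and> t \<notin> \<Union>N) \<and>
      (\<forall>N'. max_matching E N' \<and> t \<notin> \<Union>N' \<longrightarrow> card (M \<inter> N') \<le> card (M \<inter> N))"
    using missed card_mono[OF finM, of "M \<inter> _"]
    by (elim exE, intro ex_has_greatest_nat[where b = "Suc (card M)"]) (auto simp: less_Suc_eq_le)
  then obtain N where N: "max_matching E N" "t \<notin> \<Union>N"
    and best: "\<And>N'. max_matching E N' \<Longrightarrow> t \<notin> \<Union>N' \<Longrightarrow> card (M \<inter> N') \<le> card (M \<inter> N)"
    by blast
  have mN: "matching E N" and finN: "finite N"
    using N(1) matching_finite[OF G] by (auto simp: max_matching_def)
  have covN: "u \<in> \<Union>N" "v \<in> \<Union>N"
    using ut tv N ne by (auto simp: never_both_missed_def)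
  have fin: "finite (\<Union>M)" "finite (\<Union>N)"
    using Union_matching_subset[OF G mM] Union_matching_subset[OF G mN] simple_graphD(1)[OF G]
    by (auto intro: finite_subset)
  have cards: "card (\<Union>M) = card (\<Union>N)"
    using card_Union_matching[OF G] mM mN max_matching_card_eq[OF M(1) N(1)] by simp
  \<comment> \<open>Otherwise \<open>N\<close> would cover one vertex more than \<open>M\<close>, gaining \<open>u\<close> and
    \<open>v\<close> and losing at most \<open>t\<close>.\<close>
  have "\<not> \<Union>M - {t} \<subseteq> \<Union>N"
  proof
    assume "\<Union>M - {t} \<subseteq> \<Union>N"
    then have "insert u (insert v (\<Union>M - {t})) \<subseteq> \<Union>N" using covN by blast
    then have "card (insert u (insert v (\<Union>M - {t}))) \<le> card (\<Union>N)"
      using fin by (intro card_mono)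
    moreover have "card (insert u (insert v (\<Union>M - {t}))) = card (\<Union>M - {t}) + 2"
      using fin M(2,3) \<open>u \<noteq> v\<close> by (subst card_insert_disjoint; auto)+
    moreover have "card (\<Union>M - {t}) + 1 \<ge> card (\<Union>M)"
      using card_Diff1_le[of "\<Union>M" t] card_Suc_Diff1[OF fin(1), of t] by (cases "t \<in> \<Union>M") auto
    ultimately show False using cards by simp
  qed
  then obtain x e where x: "x \<noteq> t" "x \<notin> \<Union>N" and e: "e \<in> M" "x \<in> e" by blast
  have eE: "e \<in> E" using e mM by (auto simp: matching_def)
  obtain y where y: "e = {x, y}" "y \<noteq> x" using edge_other_end[OF G eE e(2)] by blast
  have "e \<inter> \<Union>N \<noteq> {}" by (rule max_matching_meets_edge[OF G N(1) eE])
  then have "y \<in> \<Union>N" using x y by auto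
  then obtain f where f: "f \<in> N" "y \<in> f" by blast
  have "e \<notin> N" using x e by auto
  have "f \<notin> M" using mM e f y \<open>e \<notin> N\<close> by (fastforce simp: matching_def)
  let ?N' = "insert e (N - {f})"
  have yonly: "y \<notin> g" if "g \<in> N" "g \<noteq> f" for g
    using mN f that by (auto simp: matching_def)
  have "matching E ?N'"
    using mN eE x(2) y(1) yonly by (auto simp: matching_def)
  moreover have "card ?N' = card N"
    using finN \<open>e \<notin> N\<close> f(1) card_Suc_Diff1[of N f] by simp
  ultimately have "max_matching E ?N'" by (metis N(1) max_matchingI_card)
  moreover have "t \<notin> \<Union>?N'" using N(2) x y \<open>y \<in> \<Union>N\<close> by auto
  ultimately have "card (M \<inter> ?N') \<le> card (M \<inter> N)" by (rule best)
  moreover have "M \<inter> ?N' = insert e (M \<inter> N)" using e \<open>f \<notin> M\<close> by auto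
  ultimately show False using finM \<open>e \<notin> N\<close> by simp
qed

text \<open>Every matching misses at least \<open>card P - card U\<close> vertices, because an odd set in
  \<open>P\<close> that is completely covered uses up a vertex of \<open>U\<close>; so \<open>U\<close> and \<open>P\<close>
  account for all the vertices that \<open>M\<close> misses. The members of \<open>P\<close> stand for the odd
  components of the graph without \<open>U\<close>; they are described by the edges leaving them,
  which is the form that counting arguments use.\<close>

definition tutte_berge_certificate ::
  "'a set \<Rightarrow> 'a set set \<Rightarrow> 'a set set \<Rightarrow> 'a set \<Rightarrow> 'a set set \<Rightarrow> bool" where
  "tutte_berge_certificate V E M U P \<longleftrightarrow>
     max_matching E M \<and> U \<subseteq> V \<and> card P = card (V - \<Union>M) + card U \<and> pairwise disjnt P \<and>
     (\<forall>C\<in>P. C \<subseteq> V - U \<and> odd (card C) \<and> (\<forall>e\<in>E. e \<inter> C \<noteq> {} \<longrightarrow> e \<subseteq> C \<union> U))"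

text \<open>This is the hard half of the Tutte-Berge formula, with Tutte's theorem as the case in which
  \<open>M\<close> is not perfect. If a vertex \<open>v\<close> lies in every maximum matching, its deletion
  lowers the matching number by exactly one and raises the number of missed vertices by one; the
  certificate of the smaller graph works with \<open>v\<close> added to \<open>U\<close>. If every vertex is
  missed by some maximum matching, \<open>never_both_missed E\<close> is an equivalence relation.\<close>

theorem tutte_berge:
  assumes "simple_graph V E"
  shows "\<exists>M U P. tutte_berge_certificate V E M U P"
  using assms
proof (induction "card V" arbitrary: V E rule: less_induct)
  case less
  note G = less.prems
  obtain M where M: "max_matching E M" using max_matching_exists[OF G] .
  have mM: "matching E M" using M by (simp add: max_matching_def)
  have UM: "\<Union>M \<subseteq> V" by (rule Union_matching_subset[OF G mM])
  have finV: "finite V" by (rule simple_graphD(1)[OF G])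
  show ?case
  proof (cases "\<exists>v\<in>V. \<forall>M. max_matching E M \<longrightarrow> v \<in> \<Union>M")
    case True
    then obtain v where v: "v \<in> V" and forced: "\<And>M. max_matching E M \<Longrightarrow> v \<in> \<Union>M" by blast
    define E' where "E' = {e \<in> E. v \<notin> e}"
    have G': "simple_graph (V - {v}) E'" using G by (auto simp: simple_graph_def E'_def)
    have "card (V - {v}) < card V" using v finV by (rule card_Diff1_less[rotated])
    from less.hyps[OF this G'] obtain M' U P where
      "tutte_berge_certificate (V - {v}) E' M' U P" by blast
    then have M': "max_matching E' M'" and U: "U \<subseteq> V - {v}"
      and P: "card P = card (V - {v} - \<Union>M') + card U" "pairwise disjnt P"
        "\<And>C. C \<in> P \<Longrightarrow> C \<subseteq> V - {v} - U \<and> odd (card C)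
           \<and> (\<forall>e\<in>E'. e \<inter> C \<noteq> {} \<longrightarrow> e \<subseteq> C \<union> U)"
      by (simp_all add: tutte_berge_certificate_def)
    have mM': "matching E' M'" using M' by (simp add: max_matching_def)
    have UM': "\<Union>M' \<subseteq> V - {v}" by (rule Union_matching_subset[OF G' mM'])
    obtain e where e: "e \<in> M" "v \<in> e" using forced[OF M] by blast
    have "matching E' (M - {e})" using mM e unfolding matching_def E'_def by blast
    then have "card (M - {e}) \<le> card M'" using M' by (simp add: max_matching_def)
    moreover have "card M = Suc (card (M - {e}))"
      using matching_finite[OF G mM] e(1) by (rule card.remove)
    moreover have "card M' < card M"
    proof (rule ccontr)
      assume "\<not> card M' < card M"
      moreover have "matching E M'" using mM' by (auto simp: matching_def E'_def)
      ultimately have "max_matching E M'" using M by (auto simp: max_matching_def)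
      from forced[OF this] show False using UM' by auto
    qed
    ultimately have "card M = Suc (card M')" by linarith
    then have "card (\<Union>M) = card (\<Union>M') + 2"
      using card_Union_matching[OF G mM] card_Union_matching[OF G' mM'] by simp
    moreover have "card (V - \<Union>M) + card (\<Union>M) = card V"
      using UM finV by (metis card_Diff_subset card_mono finite_subset le_add_diff_inverse2)
    moreover have "card (V - {v} - \<Union>M') + card (\<Union>M') = card (V - {v})"
      using UM' finV
      by (metis card_Diff_subset card_mono finite_subset finite_Diff le_add_diff_inverse2)
    moreover have "card V = Suc (card (V - {v}))" using finV v by (rule card.remove)
    ultimately have def: "card (V - {v} - \<Union>M') = Suc (card (V - \<Union>M))" by linarith
    have "finite U" "v \<notin> U" using U finV finite_subset by auto
    then have "card P = card (V - \<Union>M) + card (insert v U)" using P(1) def by simp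
    moreover have "C \<subseteq> V - insert v U \<and> odd (card C)
        \<and> (\<forall>e\<in>E. e \<inter> C \<noteq> {} \<longrightarrow> e \<subseteq> C \<union> insert v U)" if "C \<in> P" for C
    proof (intro conjI ballI impI)
      show "C \<subseteq> V - insert v U" "odd (card C)" using P(3)[OF that] by auto
      fix e assume e: "e \<in> E" "e \<inter> C \<noteq> {}"
      show "e \<subseteq> C \<union> insert v U"
      proof (cases "v \<in> e")
        case True
        with G e(1) obtain w where "e = {v, w}" using edge_other_end by metis
        then show ?thesis using e(2) P(3)[OF that] by auto
      next
        case False
        then show ?thesis using e P(3)[OF that] by (auto simp: E'_def)
      qed
    qed
    moreover have "insert v U \<subseteq> V" using v U by auto
    ultimately have "tutte_berge_certificate V E M (insert v U) P"
      using M P(2) by (simp add: tutte_berge_certificate_def)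
    then show ?thesis by blast
  next
    case False
    then have missed: "\<And>t. t \<in> V \<Longrightarrow> \<exists>M. max_matching E M \<and> t \<notin> \<Union>M" by blast
    \<comment> \<open>Vertices of \<open>D\<close> are pairwise inequivalent, as \<open>M\<close> itself misses them all, so
      each class \<open>K u\<close> with \<open>u\<close> in \<open>D\<close> contains only the one missed vertex
      \<open>u\<close>.\<close>
    define D where "D = V - \<Union>M"
    define K where "K u = {w \<in> V. never_both_missed E u w}" for u
    have self: "u \<in> K u" if "u \<in> D" for u
      using that by (simp add: K_def D_def never_both_missed_def)
    have trans: "never_both_missed E u v"
      if "never_both_missed E u t" "never_both_missed E t v" "t \<in> V" for u t v
      using never_both_missed_trans[OF G missed[OF that(3)] that(1,2)] .
    have sep: "u = w" if "u \<in> D" "w \<in> D" "never_both_missed E u w" for u w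
      using that M by (auto simp: D_def never_both_missed_def)
    have same: "u = w" if "u \<in> D" "w \<in> D" "x \<in> K u" "x \<in> K w" for u w x
    proof (rule sep[OF that(1,2)])
      show "never_both_missed E u w"
        using that(3,4) never_both_missed_sym[of E w x] by (auto simp: K_def intro: trans[of u x])
    qed
    have closed: "e \<subseteq> K u" if e: "e \<in> E" "e \<inter> K u \<noteq> {}" for e u
    proof -
      obtain x where x: "x \<in> e" "x \<in> K u" using e(2) by blast
      obtain y where y: "e = {x, y}" "y \<in> V" using edge_other_end[OF G e(1) x(1)] by blast
      have "never_both_missed E x y" using never_both_missed_edge[OF G] e(1) y by simp
      then show ?thesis using x y trans[of u x y] by (auto simp: K_def)
    qed
    have odd: "odd (card (K u))" if u: "u \<in> D" for u
    proof -
      \<comment> \<open>\<open>M\<close> pairs off the vertices of the class other than \<open>u\<close> among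
        themselves.\<close>
      let ?M = "{e \<in> M. e \<subseteq> K u}"
      have "x \<in> \<Union>?M" if x: "x \<in> K u" "x \<noteq> u" for x
      proof -
        have "x \<in> \<Union>M" using sep[OF u, of x] x by (auto simp: D_def K_def)
        then obtain e where "e \<in> M" "x \<in> e" by blast
        then show ?thesis using closed[of e u] x(1) mM by (auto simp: matching_def)
      qed
      then have "K u = insert u (\<Union>?M)" using self[OF u] by blast
      moreover have "u \<notin> \<Union>?M" using u by (auto simp: D_def)
      moreover have "finite (\<Union>?M)" using UM finV by (auto intro: finite_subset)
      ultimately have "card (K u) = Suc (card (\<Union>?M))" by (metis card_insert_disjoint)
      moreover have "matching E ?M" using mM by (auto simp: matching_def)
      ultimately show ?thesis using card_Union_matching[OF G, of ?M] by simp
    qed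
    have "inj_on K D" using same self by (intro inj_onI) metis
    then have "card (K ` D) = card (V - \<Union>M) + card ({} :: 'a set)"
      by (simp add: card_image D_def)
    moreover have "pairwise disjnt (K ` D)"
      using same unfolding pairwise_def disjnt_def by blast
    moreover have "\<forall>C\<in>K ` D. C \<subseteq> V - {} \<and> odd (card C) \<and> (\<forall>e\<in>E. e \<inter> C \<noteq> {} \<longrightarrow> e \<subseteq> C \<union> {})"
      using odd closed by (auto simp: K_def)
    ultimately have "tutte_berge_certificate V E M {} (K ` D)"
      using M by (simp add: tutte_berge_certificate_def)
    then show ?thesis by blast
  qed
qed

section \<open>Edge cuts in cubic graphs\<close>

definition edge_cut :: "'a set set \<Rightarrow> 'a set \<Rightarrow> 'a set set" where
  "edge_cut E C = {e \<in> E. e \<inter> C \<noteq> {} \<and> \<not> e \<subseteq> C}"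

text \<open>The handshake lemma for a set of vertices: an edge inside \<open>C\<close> is counted at both ends,
  an edge leaving \<open>C\<close> at one.\<close>

lemma degree_sum:
  assumes G: "simple_graph V E" and C: "C \<subseteq> V"
  shows "(\<Sum>v\<in>C. degree E v) = 2 * card {e \<in> E. e \<subseteq> C} + card (edge_cut E C)"
proof -
  have finE: "finite E" and finC: "finite C"
    using simple_graphD[OF G] C finite_subset by auto
  have "(\<Sum>v\<in>C. degree E v) = (\<Sum>v\<in>C. \<Sum>e\<in>E. if v \<in> e then 1 else 0)"
    using finE by (simp add: degree_def sum.If_cases Int_def)
  also have "\<dots> = (\<Sum>e\<in>E. \<Sum>v\<in>C. if v \<in> e then 1 else 0)" by (rule sum.swap)
  also have "\<dots> = (\<Sum>e\<in>E. card (C \<inter> e))"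
    using finC by (simp add: sum.If_cases Int_def)
  also have "\<dots> = (\<Sum>e\<in>E. (if e \<subseteq> C then 2 else 0) + (if e \<in> edge_cut E C then 1 else 0))"
  proof (rule sum.cong)
    fix e assume e: "e \<in> E"
    then have "card e = 2" using simple_graphD[OF G] by auto
    then obtain x y where "e = {x, y}" "x \<noteq> y" by (auto simp: card_2_iff)
    then show "card (C \<inter> e) = (if e \<subseteq> C then 2 else 0) + (if e \<in> edge_cut E C then 1 else 0)"
      using e by (auto simp: edge_cut_def Int_insert_right)
  qed simp
  also have "\<dots> = 2 * card {e \<in> E. e \<subseteq> C} + card (edge_cut E C)"
  proof -
    have "E \<inter> edge_cut E C = edge_cut E C" by (auto simp: edge_cut_def)
    then show ?thesis using finE by (simp add: sum.distrib sum.If_cases Int_def)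
  qed
  finally show ?thesis .
qed

lemma cubic_parity:
  assumes "simple_graph V E" "cubic V E" "C \<subseteq> V"
  shows "odd (card (edge_cut E C)) \<longleftrightarrow> odd (card C)"
proof -
  have "(\<Sum>v\<in>C. degree E v) = (\<Sum>v\<in>C. 3)"
    using assms(2,3) by (intro sum.cong) (auto simp: cubic_def)
  then have "3 * card C = 2 * card {e \<in> E. e \<subseteq> C} + card (edge_cut E C)"
    using degree_sum[OF assms(1,3)] by simp
  then show ?thesis by presburger
qed

lemma cubic_even_order:
  assumes "simple_graph V E" "cubic V E"
  shows "even (card V)"
proof -
  have "edge_cut E V = {}" using simple_graphD(3)[OF assms(1)] by (auto simp: edge_cut_def)
  then show ?thesis using cubic_parity[OF assms order_refl] by simp
qed

text \<open>A path from \<open>A\<close> to its complement has a first step out of \<open>A\<close>.\<close>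

lemma connected_graph_crossing:
  assumes con: "connected_graph W F" and A: "A \<subseteq> W" "A \<noteq> {}" "A \<noteq> W"
  obtains x y where "{x, y} \<in> F" "x \<in> A" "y \<notin> A"
proof -
  obtain a b where a: "a \<in> A" and b: "b \<in> W" "b \<notin> A" using A by blast
  have "(a, b) \<in> {(x, y). {x, y} \<in> F}\<^sup>*" using con a b A(1) by (auto simp: connected_graph_def)
  then have "\<exists>x y. {x, y} \<in> F \<and> x \<in> A \<and> y \<notin> A"
    using a b(2) by (induction rule: rtrancl_induct) blast+
  then show thesis using that by blast
qed

lemma biconnected_delete_vertex:
  "k_connected 2 V E \<Longrightarrow> x \<in> V \<Longrightarrow> connected_graph (V - {x}) {e \<in> E. e \<subseteq> V - {x}}"
  by (simp add: k_connected_def)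

text \<open>The number of edges leaving \<open>C\<close> is odd by the handshake lemma. If it were 1, removing
  the end \<open>x\<close> of that edge in \<open>C\<close> would separate the rest of \<open>C\<close> from the
  vertices outside; and \<open>C = {x}\<close> is excluded because \<open>x\<close> has degree 3.\<close>

lemma odd_edge_cut_ge_3:
  assumes G: "simple_graph V E" and K: "k_connected 2 V E" and cub: "cubic V E"
    and C: "C \<subseteq> V" "odd (card C)"
  shows "3 \<le> card (edge_cut E C)"
proof -
  have odd: "odd (card (edge_cut E C))" using cubic_parity[OF G cub C(1)] C(2) by simp
  have "card (edge_cut E C) \<noteq> 1"
  proof
    assume one: "card (edge_cut E C) = 1"
    then obtain e where e: "edge_cut E C = {e}" by (auto simp: card_1_singleton_iff)
    then have eE: "e \<in> E" "e \<inter> C \<noteq> {}" "\<not> e \<subseteq> C" by (auto simp: edge_cut_def)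
    then obtain x where x: "x \<in> e" "x \<in> C" by blast
    obtain y where y: "e = {x, y}" "y \<in> V" using edge_other_end[OF G eE(1) x(1)] by blast
    have yC: "y \<notin> C" using eE(3) y x by auto
    have "C \<noteq> {x}"
    proof
      assume "C = {x}"
      then have "{e \<in> E. x \<in> e} = edge_cut E C"
        using simple_graphD(4)[OF G, of "{x}"] by (auto simp: edge_cut_def subset_singleton_iff)
      moreover have "card {e \<in> E. x \<in> e} = 3"
        using cub C(1) x(2) by (auto simp: cubic_def degree_def)
      ultimately show False using one by simp
    qed
    moreover have "connected_graph (V - {x}) {e \<in> E. e \<subseteq> V - {x}}"
      using biconnected_delete_vertex[OF K] x C(1) by blast
    moreover have "C - {x} \<subseteq> V - {x}" "C - {x} \<noteq> V - {x}" using C(1) y(2) yC x(2) by auto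
    ultimately obtain p q where "{p, q} \<in> {e \<in> E. e \<subseteq> V - {x}}" "p \<in> C - {x}" "q \<notin> C - {x}"
      using x(2) connected_graph_crossing[of "V - {x}" _ "C - {x}"] by blast
    then have "{p, q} \<in> edge_cut E C" "x \<notin> {p, q}" by (auto simp: edge_cut_def)
    then show False using e x by auto
  qed
  moreover have "card (edge_cut E C) \<noteq> 0" using odd by presburger
  moreover have "card (edge_cut E C) \<noteq> 2" using odd by presburger
  ultimately show ?thesis by linarith
qed

section \<open>Two deleted edges leave a perfect matching\<close>

text \<open>Choosing a common point with \<open>e\<close> for each member is injective, as members are
  disjoint.\<close>

lemma card_disjoint_meeting_le:
  assumes "finite e" "pairwise disjnt P"
  shows "card {C \<in> P. e \<inter> C \<noteq> {}} \<le> card e"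
proof -
  define g where "g C = (SOME x. x \<in> e \<inter> C)" for C
  have g: "g C \<in> e \<inter> C" if "e \<inter> C \<noteq> {}" for C
    using that unfolding g_def by (metis ex_in_conv someI_ex)
  have "inj_on g {C \<in> P. e \<inter> C \<noteq> {}}"
  proof (rule inj_onI)
    fix C D assume C: "C \<in> {C \<in> P. e \<inter> C \<noteq> {}}" and D: "D \<in> {C \<in> P. e \<inter> C \<noteq> {}}" and "g C = g D"
    then have "C \<inter> D \<noteq> {}" using g[of C] g[of D] by auto
    then show "C = D" using C D assms(2) by (auto simp: pairwise_def disjnt_def)
  qed
  then show ?thesis using g assms(1) by (intro card_inj_on_le[where f = g]) auto
qed

lemma sum_card_swap:
  assumes "finite A" "finite B"
  shows "(\<Sum>x\<in>A. card {y \<in> B. R x y}) = (\<Sum>y\<in>B. card {x \<in> A. R x y})"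
proof -
  have "(\<Sum>x\<in>A. card {y \<in> B. R x y}) = (\<Sum>x\<in>A. \<Sum>y\<in>B. if R x y then 1 else 0)"
    using assms by (simp add: sum.If_cases Int_def)
  also have "\<dots> = (\<Sum>y\<in>B. \<Sum>x\<in>A. if R x y then 1 else 0)" by (rule sum.swap)
  also have "\<dots> = (\<Sum>y\<in>B. card {x \<in> A. R x y})"
    using assms by (simp add: sum.If_cases Int_def)
  finally show ?thesis .
qed

text \<open>Count the edges of the whole graph that leave the odd sets \<open>C\<close> of a Tutte-Berge
  certificate for \<open>E - S\<close>, once for each set that they leave. Such an edge is in \<open>S\<close> and
  then meets at most two of the sets, or it has an end in \<open>U\<close>, which lies outside all
  of the sets, and then it meets at most one. With \<open>T\<close> the set of edges at \<open>U\<close>,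
  this bounds the count by \<open>2 * card S + card T\<close>, which is too small.\<close>

theorem perfect_matching_avoiding_two_edges:
  assumes G: "simple_graph V E" and K: "k_connected 2 V E" and cub: "cubic V E"
    and S: "S \<subseteq> E" "card S \<le> 2"
  shows "\<exists>M. perfect_matching V (E - S) M"
proof (rule ccontr)
  assume no_pm: "\<not> ?thesis"
  have finV: "finite V" and finE: "finite E" using simple_graphD[OF G] by auto
  have finS: "finite S" using S(1) finE by (rule finite_subset)
  have G': "simple_graph V (E - S)" using G by (rule simple_graph_subset) auto
  obtain M U P where "tutte_berge_certificate V (E - S) M U P" using tutte_berge[OF G'] by blast
  then have M: "max_matching (E - S) M" and U: "U \<subseteq> V"
    and P: "card P = card (V - \<Union>M) + card U" "pairwise disjnt P"
    and PC: "\<And>C. C \<in> P \<Longrightarrow> C \<subseteq> V - U \<and> odd (card C)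
         \<and> (\<forall>e\<in>E - S. e \<inter> C \<noteq> {} \<longrightarrow> e \<subseteq> C \<union> U)"
    by (simp_all add: tutte_berge_certificate_def)
  have finU: "finite U" using U finV by (rule finite_subset)
  have PV: "C \<subseteq> V" "odd (card C)" if "C \<in> P" for C using PC[OF that] by auto
  have finP: "finite P" using PV finV by (intro finite_subset[of P "Pow V"]) auto
  have mM: "matching (E - S) M" using M by (simp add: max_matching_def)
  have UM: "\<Union>M \<subseteq> V" by (rule Union_matching_subset[OF G' mM])
  have "perfect_matching V (E - S) M" if "\<Union>M = V"
    using mM that unfolding perfect_matching_def matching_def by simp
  then have "\<Union>M \<noteq> V" using no_pm by blast
  then have "V - \<Union>M \<noteq> {}" using UM by blast
  then have "card (V - \<Union>M) \<noteq> 0" using finV by (metis card_0_eq finite_Diff)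
  moreover have "card (V - \<Union>M) = card V - 2 * card M"
    using card_Diff_subset[OF finite_subset[OF UM finV] UM] card_Union_matching[OF G' mM] by simp
  then have "even (card (V - \<Union>M))" using cubic_even_order[OF G cub] by simp
  \<comment> \<open>Parity turns the one missed vertex into two; the excess of 2 is what tolerates two
    deleted edges.\<close>
  ultimately have "2 \<le> card (V - \<Union>M)" by presburger
  then have many: "card U + 2 \<le> card P" using P(1) by simp
  define T where "T = (\<Union>u\<in>U. {e \<in> E. u \<in> e})"
  have finT: "finite T" using finE finU by (auto simp: T_def)
  have "card T \<le> (\<Sum>u\<in>U. card {e \<in> E. u \<in> e})" unfolding T_def using finU by (rule card_UN_le)
  also have "\<dots> = (\<Sum>u\<in>U. 3)"
    using U cub by (intro sum.cong) (auto simp: cubic_def degree_def)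
  finally have cT: "card T \<le> 3 * card U" by simp
  have split: "card (edge_cut E C) \<le> card {e \<in> S. e \<inter> C \<noteq> {}} + card {e \<in> T. e \<inter> C \<noteq> {}}"
    if "C \<in> P" for C
  proof -
    have "edge_cut E C \<subseteq> {e \<in> S. e \<inter> C \<noteq> {}} \<union> {e \<in> T. e \<inter> C \<noteq> {}}"
      using PC[OF that] by (fastforce simp: edge_cut_def T_def)
    then have "card (edge_cut E C) \<le> card ({e \<in> S. e \<inter> C \<noteq> {}} \<union> {e \<in> T. e \<inter> C \<noteq> {}})"
      using finS finT by (intro card_mono) auto
    also have "\<dots> \<le> card {e \<in> S. e \<inter> C \<noteq> {}} + card {e \<in> T. e \<inter> C \<noteq> {}}" by (rule card_Un_le)
    finally show ?thesis .
  qed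
  have inS: "card {C \<in> P. e \<inter> C \<noteq> {}} \<le> 2" if "e \<in> S" for e
    using card_disjoint_meeting_le[OF _ P(2), of e] simple_graphD(4,5)[OF G, of e] that S(1) by auto
  have inT: "card {C \<in> P. e \<inter> C \<noteq> {}} \<le> 1" if e: "e \<in> T" for e
  proof -
    obtain u where u: "u \<in> U" "u \<in> e" "e \<in> E" using e by (auto simp: T_def)
    obtain w where w: "e = {u, w}" using edge_other_end[OF G u(3,2)] by blast
    have "{C \<in> P. e \<inter> C \<noteq> {}} = {C \<in> P. {w} \<inter> C \<noteq> {}}" using PC u w by blast
    then show ?thesis using card_disjoint_meeting_le[OF _ P(2), of "{w}"] by simp
  qed
  have "3 * card P = (\<Sum>C\<in>P. 3)" by simp
  also have "\<dots> \<le> (\<Sum>C\<in>P. card (edge_cut E C))"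
    by (intro sum_mono odd_edge_cut_ge_3[OF G K cub] PV)
  also have "\<dots> \<le> (\<Sum>C\<in>P. card {e \<in> S. e \<inter> C \<noteq> {}} + card {e \<in> T. e \<inter> C \<noteq> {}})"
    using split by (rule sum_mono)
  also have "\<dots> = (\<Sum>e\<in>S. card {C \<in> P. e \<inter> C \<noteq> {}}) + (\<Sum>e\<in>T. card {C \<in> P. e \<inter> C \<noteq> {}})"
    using finP finS finT
    by (simp add: sum.distrib sum_card_swap[where R = "\<lambda>C e. e \<inter> C \<noteq> {}"])
  also have "\<dots> \<le> (\<Sum>e\<in>S. 2) + (\<Sum>e\<in>T. 1)"
    using inS inT by (intro add_mono sum_mono)
  also have "\<dots> \<le> 4 + 3 * card U" using S(2) cT by simp
  finally show False using many by simp
qed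

section \<open>A pair of vertices with a common neighbour that does not separate\<close>

lemma card_neighbours:
  assumes "simple_graph V E"
  shows "card {w. {v, w} \<in> E} = degree E v"
proof -
  have "bij_betw (\<lambda>w. {v, w}) {w. {v, w} \<in> E} {e \<in> E. v \<in> e}"
    unfolding bij_betw_def
  proof
    show "inj_on (\<lambda>w. {v, w}) {w. {v, w} \<in> E}" by (auto simp: inj_on_def doubleton_eq_iff)
    show "(\<lambda>w. {v, w}) ` {w. {v, w} \<in> E} = {e \<in> E. v \<in> e}"
      using edge_other_end[OF assms] by (auto simp: image_iff) metis
  qed
  then show ?thesis unfolding degree_def by (rule bij_betw_same_card)
qed

lemma connected_graph_insert:
  assumes con: "connected_graph W F" and F: "F \<subseteq> F'" and xy: "{x, y} \<in> F'" "x \<in> W"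
  shows "connected_graph (insert y W) F'"
proof -
  let ?R = "{(x, y). {x, y} \<in> F}" and ?R' = "{(x, y). {x, y} \<in> F'}"
  have "?R\<^sup>* \<subseteq> ?R'\<^sup>*" using F by (intro rtrancl_mono) auto
  then have W: "(u, v) \<in> ?R'\<^sup>*" if "u \<in> W" "v \<in> W" for u v
    using con that by (auto simp: connected_graph_def)
  have step: "(x, y) \<in> ?R'" "(y, x) \<in> ?R'" using xy by (auto simp: insert_commute)
  have "(u, y) \<in> ?R'\<^sup>*" if "u \<in> W" for u
    using W[OF that xy(2)] step(1) by (rule rtrancl_into_rtrancl)
  moreover have "(y, u) \<in> ?R'\<^sup>*" if "u \<in> W" for u
    using step(2) W[OF xy(2) that] by (rule converse_rtrancl_into_rtrancl)
  ultimately show ?thesis using W by (auto simp: connected_graph_def)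
qed

text \<open>Among all pairs \<open>a\<close>, \<open>b\<close> with a common neighbour and all nonempty connected sets
  \<open>H\<close> avoiding them, take one with \<open>H\<close> as large as possible. If \<open>H\<close> is not all of
  \<open>V - {a, b}\<close>, no edge joins it to the rest \<open>L\<close> of that set, by maximality. As
  neither \<open>a\<close> nor \<open>b\<close> alone separates the graph, \<open>b\<close> has a neighbour in
  \<open>H\<close>, and \<open>a\<close> has a neighbour \<open>w\<close> in \<open>L\<close>. By degree 3 this \<open>w\<close> has a
  neighbour \<open>u\<close> other than \<open>a\<close> and \<open>b\<close>, again outside \<open>H\<close>. Now
  \<open>a\<close> and \<open>u\<close> have the common neighbour \<open>w\<close>, and adding \<open>b\<close> to
  \<open>H\<close> gives a larger connected set avoiding them.\<close>

lemma non_separating_pair: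
  assumes G: "simple_graph V E" and K: "k_connected 2 V E" and cub: "cubic V E"
  obtains a b v where "a \<noteq> b" "{a, v} \<in> E" "{b, v} \<in> E"
    "connected_graph (V - {a, b}) {e \<in> E. e \<subseteq> V - {a, b}}"
proof -
  \<comment> \<open>The possible sizes of \<open>H\<close>.\<close>
  define Q where "Q n \<longleftrightarrow> (\<exists>a b v H. a \<noteq> b \<and> {a, v} \<in> E \<and> {b, v} \<in> E \<and> H \<subseteq> V - {a, b} \<and>
      connected_graph H {e \<in> E. e \<subseteq> H} \<and> card H = n)" for n
  have QI: "Q (card H)" if "a \<noteq> b" "{a, v} \<in> E" "{b, v} \<in> E" "H \<subseteq> V - {a, b}"
    "connected_graph H {e \<in> E. e \<subseteq> H}" for a b v H
    unfolding Q_def using that by blast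
  have finV: "finite V" by (rule simple_graphD(1)[OF G])
  have inV: "x \<in> V" "y \<in> V" "x \<noteq> y" if "{x, y} \<in> E" for x y
    using simple_graphD(3,4)[OF G that] by auto
  have nbrs: "card {w. {v, w} \<in> E} = 3" if "v \<in> V" for v
    using card_neighbours[OF G] cub that by (simp add: cubic_def)
  have "V \<noteq> {}" using K by (auto simp: k_connected_def)
  then obtain v where v: "v \<in> V" by blast
  obtain a b c where "{w. {v, w} \<in> E} = {a, b, c}" "a \<noteq> b"
    using nbrs[OF v] by (auto simp: card_3_iff)
  then have ab: "{v, a} \<in> E" "{v, b} \<in> E" by auto
  have "connected_graph {v} {e \<in> E. e \<subseteq> {v}}" by (simp add: connected_graph_def)
  moreover have "{v} \<subseteq> V - {a, b}" using v inV(3)[OF ab(1)] inV(3)[OF ab(2)] by auto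
  moreover have "{a, v} \<in> E" "{b, v} \<in> E" using ab by (simp_all add: insert_commute)
  ultimately have "Q (card {v})" using \<open>a \<noteq> b\<close> by (intro QI)
  moreover have "\<forall>n. Q n \<longrightarrow> n \<le> card V"
    using finV by (auto simp: Q_def intro!: card_mono)
  ultimately have "\<exists>n. Q n \<and> (\<forall>m. Q m \<longrightarrow> m \<le> n)"
    by (intro ex_has_greatest_nat[where f = "\<lambda>n. n" and b = "Suc (card V)"])
      (auto simp: less_Suc_eq_le)
  then obtain n where "Q n" and max: "\<And>m. Q m \<Longrightarrow> m \<le> n" by blast
  then obtain a b v H where ab: "a \<noteq> b" "{a, v} \<in> E" "{b, v} \<in> E" and H: "H \<subseteq> V - {a, b}"
    and con: "connected_graph H {e \<in> E. e \<subseteq> H}" and n: "card H = n"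
    unfolding Q_def by blast
  have finH: "finite H" using H finV finite_subset by blast
  have Hne: "H \<noteq> {}" using con by (simp add: connected_graph_def)
  have grow: "connected_graph (insert y H) {e \<in> E. e \<subseteq> insert y H}"
    if "x \<in> H" "{x, y} \<in> E" for x y
    using con by (rule connected_graph_insert[where x = x]) (use that in auto)
  have "H = V - {a, b}"
  proof (rule ccontr)
    assume Hneq: "H \<noteq> V - {a, b}"
    have abV: "a \<in> V" "b \<in> V" using inV ab by auto
    have no_edge: "y \<in> H \<union> {a, b}" if "x \<in> H" "{x, y} \<in> E" for x y
    proof (rule ccontr)
      assume y: "y \<notin> H \<union> {a, b}"
      then have "insert y H \<subseteq> V - {a, b}" using H inV(2)[OF that(2)] by blast
      then have "Q (card (insert y H))" using grow[OF that] by (rule QI[OF ab])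
      then have "card (insert y H) \<le> card H" using max n by simp
      then show False using finH y by simp
    qed
    have Ha: "H \<subseteq> V - {a}" "H \<noteq> V - {a}" using H abV ab(1) by auto
    then obtain h b' where hb: "{h, b'} \<in> {e \<in> E. e \<subseteq> V - {a}}" "h \<in> H" "b' \<notin> H"
      using connected_graph_crossing[OF biconnected_delete_vertex[OF K abV(1)] Ha(1) Hne Ha(2)]
      by blast
    then have "b' = b" using no_edge by auto
    then have hbE: "{h, b} \<in> E" using hb by simp
    let ?L = "V - {a, b} - H"
    have Lb: "?L \<subseteq> V - {b}" "?L \<noteq> {}" "?L \<noteq> V - {b}" using H Hneq abV ab(1) by auto
    then obtain w a' where wa: "{w, a'} \<in> {e \<in> E. e \<subseteq> V - {b}}" "w \<in> ?L" "a' \<notin> ?L"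
      using connected_graph_crossing[OF biconnected_delete_vertex[OF K abV(2)] Lb] by blast
    have "a' \<notin> H" using no_edge[of a' w] wa by (auto simp: insert_commute)
    then have "a' = a" using wa by auto
    then have waE: "{w, a} \<in> E" using wa by simp
    have "\<not> {u. {w, u} \<in> E} \<subseteq> {a, b}"
    proof
      assume "{u. {w, u} \<in> E} \<subseteq> {a, b}"
      then have "card {u. {w, u} \<in> E} \<le> card {a, b}" by (intro card_mono) auto
      then show False using nbrs[of w] wa(2) ab(1) by simp
    qed
    then obtain u where u: "{w, u} \<in> E" "u \<noteq> a" "u \<noteq> b" by blast
    have uH: "u \<notin> H" using no_edge[of u w] u wa(2) by (auto simp: insert_commute)
    have "insert b H \<subseteq> V - {a, u}" using H abV ab(1) u uH by auto
    moreover have "{a, w} \<in> E" "{u, w} \<in> E" using u waE by (auto simp: insert_commute)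
    ultimately have "Q (card (insert b H))"
      using grow[OF hb(2) hbE] u(2) by (intro QI[of a u w]) auto
    then have "card (insert b H) \<le> card H" using max n by simp
    moreover have "b \<notin> H" using H by auto
    ultimately show False using finH by simp
  qed
  then show thesis using that ab con by blast
qed

text \<open>The set consists of the edges at \<open>a\<close> or \<open>b\<close> that do not lead to \<open>v\<close>, two
  at each of them; an edge joining \<open>a\<close> and \<open>b\<close> is shared, which is why the bound on
  the size is not an equality.\<close>

lemma anti_kekule_set_of_non_separating_pair:
  assumes G: "simple_graph V E" and cub: "cubic V E"
    and ab: "a \<noteq> b" "{a, v} \<in> E" "{b, v} \<in> E"
    and con: "connected_graph (V - {a, b}) {e \<in> E. e \<subseteq> V - {a, b}}"
  obtains S where "anti_kekule_set V E S" "card S \<le> 4"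
proof -
  define A where "A x = {e \<in> E. x \<in> e} - {{x, v}}" for x
  define S where "S = A a \<union> A b"
  have inV: "a \<in> V" "b \<in> V" "v \<in> V" and ne: "a \<noteq> v" "b \<noteq> v"
    using simple_graphD(3,4)[OF G ab(2)] simple_graphD(3,4)[OF G ab(3)] by auto
  have two: "card (A x) = 2" if "x \<in> V" "{x, v} \<in> E" for x
    using that cub simple_graphD(2)[OF G] by (simp add: A_def cubic_def degree_def)
  have "card S \<le> 4"
    using card_Un_le[of "A a" "A b"] two inV ab by (simp add: S_def)
  moreover have "anti_kekule_set V E S"
    unfolding anti_kekule_set_def
  proof (intro conjI notI)
    show "S \<subseteq> E" by (auto simp: S_def A_def)
    have av: "{v, a} \<in> E - S" "{v, b} \<in> E - S"
      using ab ne by (auto simp: S_def A_def insert_commute doubleton_eq_iff)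
    have "connected_graph (insert a (V - {a, b})) (E - S)"
      using con by (rule connected_graph_insert[OF _ _ av(1)]) (use inV ne in \<open>auto simp: S_def A_def\<close>)
    then have "connected_graph (insert b (insert a (V - {a, b}))) (E - S)"
      by (rule connected_graph_insert[OF _ order_refl av(2)]) (use inV ne in auto)
    moreover have "insert b (insert a (V - {a, b})) = V" using inV by auto
    ultimately show "connected_graph V (E - S)" by simp
  next
    assume "\<exists>M. perfect_matching V (E - S) M"
    then obtain M where "perfect_matching V (E - S) M" by blast
    then have M: "M \<subseteq> E - S" "\<forall>e\<in>M. \<forall>f\<in>M. e \<noteq> f \<longrightarrow> e \<inter> f = {}" "\<Union>M = V"
      by (simp_all add: perfect_matching_def)
    have "{x, v} \<in> M" if x: "x \<in> {a, b}" for x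
    proof -
      obtain e where "e \<in> M" "x \<in> e" using M(3) x inV by blast
      moreover then have "e = {x, v}" using M(1) x by (auto simp: S_def A_def)
      ultimately show ?thesis by simp
    qed
    then have "{a, v} \<in> M" "{b, v} \<in> M" by auto
    moreover have "{a, v} \<noteq> {b, v}" using ab(1) ne by (simp add: doubleton_eq_iff)
    ultimately have "{a, v} \<inter> {b, v} = {}" using M(2) by metis
    then show False by simp
  qed
  ultimately show thesis by (intro that)
qed

theorem theorem1p4:
  fixes V :: "'a set" and E :: "'a set set"
  assumes "simple_graph V E"
    and "k_connected 2 V E"
    and "cubic V E"
  shows "3 \<le> anti_kekule_number V E \<and> anti_kekule_number V E \<le> 4"
proof
  show "3 \<le> anti_kekule_number V E"
    unfolding anti_kekule_number_def
  proof (rule INF_greatest)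
    fix S assume "S \<in> {S. anti_kekule_set V E S}"
    then have "\<not> card S \<le> 2"
      using perfect_matching_avoiding_two_edges[OF assms] by (auto simp: anti_kekule_set_def)
    then have "3 \<le> card S" by simp
    then show "3 \<le> enat (card S)" by (simp add: numeral_eq_enat)
  qed
  obtain a b v where "a \<noteq> b" "{a, v} \<in> E" "{b, v} \<in> E"
    "connected_graph (V - {a, b}) {e \<in> E. e \<subseteq> V - {a, b}}"
    using non_separating_pair[OF assms] by blast
  then obtain S where S: "anti_kekule_set V E S" "card S \<le> 4"
    using anti_kekule_set_of_non_separating_pair[OF assms(1,3)] by blast
  have "anti_kekule_number V E \<le> enat (card S)"
    unfolding anti_kekule_number_def using S(1) by (intro INF_lower) simp
  also have "\<dots> \<le> 4" using S(2) by (simp add: numeral_eq_enat)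
  finally show "anti_kekule_number V E \<le> 4" .
qed

end
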